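(* $\mathrm{two}^+_+\geq\frac{7}{4}$; that is, there is no online coloring algorithm for 2-count interval graphs with competitive ratio less than $\frac{7}{4}$ in the setting where both the two interval lengths and the interval representation are known.
   Context: A 2-count interval graph is a graph having an interval representation (an assignment of closed real intervals to vertices such that two vertices are adjacent iff their intervals intersect) in which at most two distinct interval lengths occur. In the setting $\mathrm{two}^+_+$, before the first interval is presented the algorithm is told two lengths (which may depend on the clique number of the graph to be presented); then closed intervals, each having one of these two lengths, are presented one at a time (the algorithm sees the intervals themselves), and the algorithm must irrevocably assign each interval a color different from the colors of previously presented intervals intersecting it. For an online algorithm $A$, $\chi_A(G)$ denotes the maximum number of colors $A$ uses on $G$ over all presentations; $A$ is $\rho$-competitive if there is $b\in\mathbb{R}$ with $\chi_A(G)\le\rho\chi(G)+b$ for all graphs $G$ in the class; the competitive ratio of $A$ is the infimum of such $\rho$, and $\mathrm{two}^+_+$ is the infimum of the competitive ratios over all online algorithms in this setting. *)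

theory Defs
  imports "HOL-Library.Extended_Real" "Graph_Theory.Pair_Digraph"
begin

text \<open>
  Finite simple graphs are the symmetric loop-free digraphs of the locale
  \<^locale>\<open>pair_graph\<close>; an edge \<open>uv\<close> is the pair of arcs \<open>(u, v)\<close>, \<open>(v, u)\<close>.
\<close>

type_synonym ngraph = "nat pair_pre_digraph"

definition chromatic_number :: "ngraph \<Rightarrow> nat" where
  "chromatic_number G =
     (LEAST k. \<exists>c :: nat \<Rightarrow> nat. c ` pverts G \<subseteq> {..<k} \<and> (\<forall>(u, v) \<in> parcs G. c u \<noteq> c v))"


text \<open>The pair \<open>(a, b)\<close> stands for the closed interval \<open>{a..b}\<close>.\<close>

type_synonym interval = "real \<times> real"

definition len :: "interval \<Rightarrow> real" where
  "len I = snd I - fst I"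

definition meets :: "interval \<Rightarrow> interval \<Rightarrow> bool" where
  "meets I J \<longleftrightarrow> {fst I..snd I} \<inter> {fst J..snd J} \<noteq> {}"

text \<open>
  All interval lengths are positive. Admitting one-point intervals would not change the
  class of graphs below, as the intervals of a finite representation may be enlarged slightly.
\<close>

definition interval_representation :: "ngraph \<Rightarrow> (nat \<Rightarrow> interval) \<Rightarrow> bool" where
  "interval_representation G f \<longleftrightarrow>
     (\<forall>v \<in> pverts G. fst (f v) < snd (f v)) \<and>
     (\<forall>u \<in> pverts G. \<forall>v \<in> pverts G. u \<noteq> v \<longrightarrow> ((u, v) \<in> parcs G \<longleftrightarrow> meets (f u) (f v)))"

definition two_count_interval_graph :: "ngraph \<Rightarrow> bool" where
  "two_count_interval_graph G \<longleftrightarrow> pair_graph G \<and>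
     (\<exists>f. interval_representation G f \<and> card ((\<lambda>v. len (f v)) ` pverts G) \<le> 2)"


text \<open>
  An algorithm \<open>A\<close> is told the two lengths \<open>s < t\<close>; \<open>A s t past I\<close> is the colour it gives to
  the new interval \<open>I\<close> after the intervals \<open>past\<close> (oldest first). Being deterministic, it can
  recompute its earlier colours from \<open>past\<close>. It is told nothing else about the graph.
\<close>

type_synonym online_alg = "real \<Rightarrow> real \<Rightarrow> interval list \<Rightarrow> interval \<Rightarrow> nat"

definition colour :: "online_alg \<Rightarrow> real \<Rightarrow> real \<Rightarrow> interval list \<Rightarrow> nat \<Rightarrow> nat" where
  "colour A s t Is i = A s t (take i Is) (Is ! i)"

definition online_colouring_algorithm :: "online_alg \<Rightarrow> bool" where
  "online_colouring_algorithm A \<longleftrightarrow>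
     (\<forall>s t Is. 0 < s \<and> s < t \<and> (\<forall>I \<in> set Is. len I \<in> {s, t}) \<longrightarrow>
        (\<forall>j < length Is. \<forall>i < j. meets (Is ! i) (Is ! j) \<longrightarrow>
           colour A s t Is i \<noteq> colour A s t Is j))"

definition presentation :: "ngraph \<Rightarrow> real \<Rightarrow> real \<Rightarrow> (nat \<Rightarrow> interval) \<Rightarrow> nat list \<Rightarrow> bool" where
  "presentation G s t f vs \<longleftrightarrow>
     0 < s \<and> s < t \<and>
     interval_representation G f \<and> (\<forall>v \<in> pverts G. len (f v) \<in> {s, t}) \<and>
     distinct vs \<and> set vs = pverts G"

definition colours_used :: "online_alg \<Rightarrow> real \<Rightarrow> real \<Rightarrow> interval list \<Rightarrow> nat" where
  "colours_used A s t Is = card (colour A s t Is ` {..<length Is})"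

text \<open>
  The maximum includes the choice of the two lengths. Hence they may depend on the graph
  presented, in particular on its clique number, and the additive constant in the definition
  of competitiveness is independent of them.
\<close>

definition chi_alg :: "online_alg \<Rightarrow> ngraph \<Rightarrow> nat" where
  "chi_alg A G = Max {colours_used A s t (map f vs) | s t f vs. presentation G s t f vs}"

definition competitive :: "online_alg \<Rightarrow> real \<Rightarrow> bool" where
  "competitive A \<rho> \<longleftrightarrow>
     (\<exists>b :: real. \<forall>G. two_count_interval_graph G \<longrightarrow>
        real (chi_alg A G) \<le> \<rho> * real (chromatic_number G) + b)"

text \<open>The value is \<open>\<infinity>\<close> if the algorithm is not competitive for any real ratio.\<close>

definition competitive_ratio :: "online_alg \<Rightarrow> ereal" where
  "competitive_ratio A = Inf (ereal ` {\<rho>. competitive A \<rho>})"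

definition two_plus_plus :: ereal where
  "two_plus_plus = Inf (competitive_ratio ` {A. online_colouring_algorithm A})"


text \<open>The maximum defining \<^const>\<open>chi_alg\<close> is taken over a finite nonempty set.\<close>

lemma finite_colours_used:
  assumes "pair_graph G"
  shows "finite {colours_used A s t (map f vs) | s t f vs. presentation G s t f vs}"
proof (rule finite_subset)
  show "{colours_used A s t (map f vs) | s t f vs. presentation G s t f vs} \<subseteq> {..card (pverts G)}"
  proof clarsimp
    fix s t f vs assume "presentation G s t f vs"
    then have "length vs = card (pverts G)"
      using distinct_card[of vs] by (simp add: presentation_def)
    then show "colours_used A s t (map f vs) \<le> card (pverts G)"
      using card_image_le[of "{..<length vs}" "colour A s t (map f vs)"]
      by (simp add: colours_used_def)
  qed
qed simp

lemma ex_presentation: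
  assumes "two_count_interval_graph G"
  shows "\<exists>s t f vs. presentation G s t f vs"
proof -
  obtain f where f: "interval_representation G f"
    and c: "card ((\<lambda>v. len (f v)) ` pverts G) \<le> 2" and G: "pair_graph G"
    using assms by (auto simp: two_count_interval_graph_def)
  let ?L = "(\<lambda>v. len (f v)) ` pverts G"
  have fin: "finite (pverts G)"
    using G by (simp add: pair_graph_def pair_digraph_def pair_fin_digraph_def
        pair_fin_digraph_axioms_def)
  then obtain vs where vs: "distinct vs" "set vs = pverts G"
    using finite_distinct_list by blast
  have pos: "\<forall>x \<in> ?L. 0 < x"
    using f by (auto simp: interval_representation_def len_def)
  have "\<exists>s t. 0 < s \<and> s < t \<and> ?L \<subseteq> {s, t}"
  proof -
    consider "card ?L = 0" | "card ?L = 1" | "card ?L = 2" using c by linarith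
    then show ?thesis
    proof cases
      case 1
      then have "?L = {}" using fin by simp
      then show ?thesis by (intro exI[of _ 1] exI[of _ 2]) simp
    next
      case 2
      then obtain x where "?L = {x}" using card_1_singletonE by metis
      then show ?thesis using pos by (intro exI[of _ x] exI[of _ "x + 1"]) simp
    next
      case 3
      then obtain x y where xy: "?L = {x, y}" "x \<noteq> y" by (meson card_2_iff)
      then have "0 < min x y \<and> min x y < max x y \<and> ?L \<subseteq> {min x y, max x y}"
        using pos by (auto simp: min_def max_def)
      then show ?thesis by blast
    qed
  qed
  then obtain s t where "0 < s" "s < t" "?L \<subseteq> {s, t}" by blast
  then have "presentation G s t f vs"
    using f vs unfolding presentation_def by blast
  then show ?thesis by blast
qed

end

theory Submission
  imports Defs
begin

text \<open>
  Suppose that \<open>g\<close> colours can be forced by intervals of depth at most \<open>b\<close> in a short window.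
  With intervals of a much larger length \<open>l\<close>, depth \<open>3 b\<close> then suffices to force \<open>g + 4 b\<close>
  colours. Play the short game in many windows and in their translates by \<open>l\<close>. By the
  pigeonhole principle two windows receive the same colour set \<open>T\<close> and their translates the
  same set \<open>T'\<close>. Between these two windows end \<open>b\<close> long intervals, whose colours \<open>F\<close> avoid \<open>T\<close>.
  Between their translates begin \<open>2 b\<close> long intervals, which avoid \<open>T'\<close>, and whose left endpoints
  are arranged adaptively so that the leftmost ones have colours \<open>E\<close> outside \<open>T \<union> F\<close>. Finally
  \<open>2 b\<close> long intervals meet everything coloured from \<open>T \<union> T' \<union> F \<union> E\<close>. This set has at least
  \<open>g + 2 b\<close> elements: either \<open>E\<close> has \<open>b\<close> elements, disjoint from \<open>T \<union> F\<close>, or the set contains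
  \<open>T'\<close> and all \<open>2 b\<close> colours that avoid \<open>T'\<close>. Two such steps, one for each length, start from
  \<open>g = 0\<close>, \<open>b = m\<close> and end with \<open>16 m\<close> colours at depth \<open>9 m\<close>; and \<open>16 / 9 > 7 / 4\<close>.
\<close>

section \<open>Colours along a play, and depth of a list of intervals\<close>

text \<open>The history \<open>P\<close> is a parameter, so a play can be cut into consecutive
  phases, each analysed with all earlier phases as its past.\<close>

primrec trace :: "(interval list \<Rightarrow> interval \<Rightarrow> nat) \<Rightarrow> interval list \<Rightarrow> interval list \<Rightarrow> (interval \<times> nat) list"
where
  "trace c P [] = []"
| "trace c P (I # Q) = (I, c P I) # trace c (P @ [I]) Q"

definition colours :: "(interval list \<Rightarrow> interval \<Rightarrow> nat) \<Rightarrow> interval list \<Rightarrow> interval list \<Rightarrow> nat set" where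
  "colours c P Q = snd ` set (trace c P Q)"

definition depth :: "real \<Rightarrow> interval list \<Rightarrow> nat" where
  "depth p Q = length (filter (\<lambda>I. fst I \<le> p \<and> p \<le> snd I) Q)"

lemma length_trace [simp]: "length (trace c P Q) = length Q"
  by (induction Q arbitrary: P) auto

lemma map_fst_trace [simp]: "map fst (trace c P Q) = Q"
  by (induction Q arbitrary: P) auto

lemma fst_set_trace: "(I, a) \<in> set (trace c P Q) \<Longrightarrow> I \<in> set Q"
  by (induction Q arbitrary: P) auto

lemma trace_append: "trace c P (Q @ R) = trace c P Q @ trace c (P @ Q) R"
  by (induction Q arbitrary: P) auto

lemma trace_nth: "i < length Q \<Longrightarrow> trace c P Q ! i = (Q ! i, c (P @ take i Q) (Q ! i))"
  by (induction Q arbitrary: P i) (auto simp: nth_Cons split: nat.splits)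

lemma colours_append: "colours c P (Q @ R) = colours c P Q \<union> colours c (P @ Q) R"
  by (auto simp: colours_def trace_append)

lemma finite_colours [simp]: "finite (colours c P Q)"
  by (simp add: colours_def)

lemma colours_eq_image: "colours (A s t) [] Q = colour A s t Q ` {..<length Q}"
proof -
  have "set (trace (A s t) [] Q) = (\<lambda>i. trace (A s t) [] Q ! i) ` {..<length Q}"
    by (auto simp: set_conv_nth)
  then show ?thesis
    by (auto simp: colours_def colour_def trace_nth image_image)
qed

lemma depth_append [simp]: "depth p (Q @ R) = depth p Q + depth p R"
  by (simp add: depth_def)

lemma depth_replicate: "depth p (replicate n I) = (if fst I \<le> p \<and> p \<le> snd I then n else 0)"
  by (auto simp: depth_def)

lemma depth_le_length: "depth p Q \<le> length Q"
  by (simp add: depth_def)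

lemma depth_0: "(\<And>I. I \<in> set Q \<Longrightarrow> p < fst I \<or> snd I < p) \<Longrightarrow> depth p Q = 0"
  by (force simp: depth_def filter_empty_conv)

lemma meets_iff:
  "fst I \<le> snd I \<Longrightarrow> fst J \<le> snd J \<Longrightarrow> meets I J \<longleftrightarrow> fst I \<le> snd J \<and> fst J \<le> snd I"
  unfolding meets_def by (auto simp: not_le disjoint_iff)

section \<open>The game against one algorithm at one fixed pair of lengths\<close>

locale online_game =
  fixes s t :: real and c :: "interval list \<Rightarrow> interval \<Rightarrow> nat"
  assumes pos: "0 < s" "s < t"
    and proper: "\<And>Is i j. \<forall>I\<in>set Is. len I \<in> {s, t} \<Longrightarrow> j < length Is \<Longrightarrow> i < j \<Longrightarrow>
      meets (Is ! i) (Is ! j) \<Longrightarrow> c (take i Is) (Is ! i) \<noteq> c (take j Is) (Is ! j)"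
begin

definition admissible :: "interval list \<Rightarrow> bool" where
  "admissible Q \<longleftrightarrow> (\<forall>I\<in>set Q. len I \<in> {s, t})"

lemma admissible_append [simp]: "admissible (P @ Q) \<longleftrightarrow> admissible P \<and> admissible Q"
  by (auto simp: admissible_def)

lemma admissible_fst_less_snd: "admissible Q \<Longrightarrow> I \<in> set Q \<Longrightarrow> fst I < snd I"
  using pos by (force simp: admissible_def len_def)

lemma trace_proper:
  assumes "admissible P" "admissible Q" "i < j" "j < length Q" "meets (Q ! i) (Q ! j)"
  shows "snd (trace c P Q ! i) \<noteq> snd (trace c P Q ! j)"
  using proper[of "P @ Q" "length P + j" "length P + i"] assms
  by (simp add: trace_nth admissible_def ball_Un)

lemma distinct_colours_clique:
  assumes "admissible P" "admissible Q" "\<And>I J. I \<in> set Q \<Longrightarrow> J \<in> set Q \<Longrightarrow> meets I J"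
  shows "distinct (map snd (trace c P Q))"
  unfolding distinct_conv_nth
proof (intro allI impI)
  fix i j assume "i < length (map snd (trace c P Q))" "j < length (map snd (trace c P Q))" "i \<noteq> j"
  then show "map snd (trace c P Q) ! i \<noteq> map snd (trace c P Q) ! j"
    using trace_proper[OF assms(1,2), of i j] trace_proper[OF assms(1,2), of j i] assms(3)
    by (cases "i < j") (auto simp: nth_map)
qed

lemma card_colours_clique:
  assumes "admissible P" "admissible Q" "\<And>I J. I \<in> set Q \<Longrightarrow> J \<in> set Q \<Longrightarrow> meets I J"
  shows "card (colours c P Q) = length Q"
  using distinct_card[OF distinct_colours_clique[OF assms]] by (simp add: colours_def)

lemma colour_neq_later:
  assumes "admissible P" "admissible Q" "admissible R"
    and I: "(I, a) \<in> set (trace c P Q)" and J: "e \<in> colours c (P @ Q) R"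
    and m: "\<And>J. J \<in> set R \<Longrightarrow> meets I J"
  shows "a \<noteq> e"
proof -
  obtain i where i: "i < length Q" "trace c P Q ! i = (I, a)"
    using I by (auto simp: in_set_conv_nth)
  obtain j where j: "j < length R" "snd (trace c (P @ Q) R ! j) = e"
    using J by (auto simp: in_set_conv_nth colours_def)
  have "Q ! i = I" using i trace_nth by (metis fst_conv)
  then show ?thesis
    using trace_proper[of P "Q @ R" i "length Q + j"] assms(1-3) i j m
    by (simp add: trace_append nth_append)
qed

text \<open>The next left endpoint bisects the remaining range, so that later intervals
  start on whichever side of it the colour it receives calls for.\<close>

lemma separation:
  assumes "u < v"
  shows "\<exists>Q q. length Q = n \<and> u < q \<and> q < v \<and>
    (\<forall>I\<in>set Q. u < fst I \<and> fst I < v \<and> snd I = fst I + l) \<and>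
    length (filter (\<lambda>I. fst I \<le> q) Q) \<le> b \<and>
    (\<forall>(I, a)\<in>set (trace c P Q). fst I \<le> q \<longrightarrow> a \<notin> C) \<and>
    (length (filter (\<lambda>I. fst I \<le> q) Q) = b \<or> (\<forall>(I, a)\<in>set (trace c P Q). q < fst I \<longrightarrow> a \<in> C))"
  using assms
proof (induction n arbitrary: P u v b)
  case 0
  then show ?case by (intro exI[of _ "[]"] exI[of _ "(u + v) / 2"]) auto
next
  case (Suc n)
  let ?x = "(u + v) / 2"
  let ?I = "(?x, ?x + l)"
  have x: "u < ?x" "?x < v" using Suc.prems by auto
  \<comment> \<open>An interval whose colour avoids \<open>C\<close> is kept left of the final
    \<open>q\<close> and uses up one of \<open>b\<close> places. Any other interval ends up right of
    \<open>q\<close>. Once no place is left, all further intervals go right and the alternative with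
    exactly \<open>b\<close> intervals holds.\<close>
  show ?case
  proof (cases "c P ?I \<notin> C \<and> b > 0")
    case True
    obtain Q q where "length Q = n \<and> ?x < q \<and> q < v \<and>
      (\<forall>I\<in>set Q. ?x < fst I \<and> fst I < v \<and> snd I = fst I + l) \<and>
      length (filter (\<lambda>I. fst I \<le> q) Q) \<le> b - 1 \<and>
      (\<forall>(I, a)\<in>set (trace c (P @ [?I]) Q). fst I \<le> q \<longrightarrow> a \<notin> C) \<and>
      (length (filter (\<lambda>I. fst I \<le> q) Q) = b - 1 \<or>
        (\<forall>(I, a)\<in>set (trace c (P @ [?I]) Q). q < fst I \<longrightarrow> a \<in> C))"
      using Suc.IH[OF x(2), of "b - 1" "P @ [?I]"] by (elim exE)
    then show ?thesis using True x
      by (intro exI[of _ "?I # Q"] exI[of _ q]) fastforce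
  next
    case False
    obtain Q q where "length Q = n \<and> u < q \<and> q < ?x \<and>
      (\<forall>I\<in>set Q. u < fst I \<and> fst I < ?x \<and> snd I = fst I + l) \<and>
      length (filter (\<lambda>I. fst I \<le> q) Q) \<le> b \<and>
      (\<forall>(I, a)\<in>set (trace c (P @ [?I]) Q). fst I \<le> q \<longrightarrow> a \<notin> C) \<and>
      (length (filter (\<lambda>I. fst I \<le> q) Q) = b \<or>
        (\<forall>(I, a)\<in>set (trace c (P @ [?I]) Q). q < fst I \<longrightarrow> a \<in> C))"
      using Suc.IH[OF x(1), of b "P @ [?I]"] by (elim exE)
    then show ?thesis using False x
      by (intro exI[of _ "?I # Q"] exI[of _ q]) fastforce
  qed
qed

section \<open>Forcing colours in short windows\<close>

text \<open>Arbitrary \<open>P\<close> and \<open>x\<close> allow a strategy to be replayed at any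
  place after any earlier play. Only the depth of the new intervals is bounded, so depths of
  different phases must be combined separately.\<close>

definition forces :: "real \<Rightarrow> nat \<Rightarrow> nat \<Rightarrow> bool" where
  "forces d k g \<longleftrightarrow> (\<forall>P x. admissible P \<longrightarrow>
     (\<exists>Q. admissible Q \<and> (\<forall>I\<in>set Q. x \<le> fst I \<and> snd I \<le> x + d) \<and>
       (\<forall>p. depth p Q \<le> k) \<and> g \<le> card (colours c P Q)))"

lemma forces_nothing: "forces 0 k 0"
  unfolding forces_def by (auto intro!: exI[of _ "[]"] simp: admissible_def depth_def)

text \<open>Intervals are selected by position, not by the phase that played them, so the set can
  only grow when \<open>Q\<close> is extended.\<close>

definition zone :: "interval list \<Rightarrow> interval list \<Rightarrow> real \<Rightarrow> real \<Rightarrow> nat set" where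
  "zone P Q d z = {a. \<exists>I. (I, a) \<in> set (trace c P Q) \<and> z \<le> fst I \<and> snd I \<le> z + d}"

lemma zone_subset_colours: "zone P Q d z \<subseteq> colours c P Q"
  by (force simp: zone_def colours_def)

text \<open>The strategy is replayed in one window after another, with all previous windows in its
  past. The windows are disjoint, so at each point only one replay contributes to the depth.\<close>

lemma forces_zones:
  assumes "forces d k g" "finite Z" "\<And>y z. y \<in> Z \<Longrightarrow> z \<in> Z \<Longrightarrow> y < z \<Longrightarrow> y + d < z" "admissible P"
  shows "\<exists>Q. admissible Q \<and> (\<forall>I\<in>set Q. \<exists>z\<in>Z. z \<le> fst I \<and> snd I \<le> z + d) \<and>
    (\<forall>p. depth p Q \<le> k) \<and> (\<forall>z\<in>Z. g \<le> card (zone P Q d z))"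
  using assms(2,3)
proof (induction Z)
  case empty
  show ?case by (auto intro!: exI[of _ "[]"] simp: admissible_def depth_def)
next
  case (insert y Z)
  then obtain Q where Q: "admissible Q" "\<And>I. I \<in> set Q \<Longrightarrow> \<exists>z\<in>Z. z \<le> fst I \<and> snd I \<le> z + d"
    "\<And>p. depth p Q \<le> k" "\<And>z. z \<in> Z \<Longrightarrow> g \<le> card (zone P Q d z)"
    by (metis insertCI)
  obtain R where R: "admissible R" "\<And>I. I \<in> set R \<Longrightarrow> y \<le> fst I \<and> snd I \<le> y + d"
    "\<And>p. depth p R \<le> k" "g \<le> card (colours c (P @ Q) R)"
    using assms(1,4) Q(1) unfolding forces_def by (metis admissible_append)
  have zs: "zone P Q d z \<subseteq> zone P (Q @ R) d z" for z
    by (auto simp: zone_def trace_append)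
  have fin: "finite (zone P (Q @ R) d z)" for z
    by (rule finite_subset[OF zone_subset_colours]) simp
  have "g \<le> card (zone P (Q @ R) d z)" if "z \<in> insert y Z" for z
  proof (cases "z = y")
    case True
    have "colours c (P @ Q) R \<subseteq> zone P (Q @ R) d y"
      using R(2) fst_set_trace by (fastforce simp: colours_def zone_def trace_append)
    then show ?thesis using R(4) card_mono[OF fin] True le_trans by blast
  next
    case False
    then show ?thesis using Q(4)[of z] that card_mono[OF fin zs, of z] by auto
  qed
  moreover have "depth p (Q @ R) \<le> k" for p
  proof (cases "y \<le> p \<and> p \<le> y + d")
    case True
    have "depth p Q = 0"
    proof (rule depth_0)
      fix I assume "I \<in> set Q"
      then obtain z where z: "z \<in> Z" "z \<le> fst I" "snd I \<le> z + d" using Q(2) by blast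
      then have "z \<noteq> y" using insert.hyps by auto
      then show "p < fst I \<or> snd I < p"
        using insert.prems[of y z] insert.prems[of z y] z True by fastforce
    qed
    then show ?thesis using R(3) by simp
  next
    case False
    have "depth p R = 0" by (rule depth_0) (use R(2) False in force)
    then show ?thesis using Q(3) by simp
  qed
  ultimately show ?case using Q(1,2) R(1,2)
    by (intro exI[of _ "Q @ R"]) (auto; metis)
qed


section \<open>The recursive step with intervals of one length\<close>

lemma forces_step:
  assumes forces: "forces d b g" and l: "l \<in> {s, t}" and d: "0 \<le> d"
    and large: "real (4 ^ (g + 4 * b) + 1) * (d + 1) \<le> l"
  shows "forces (4 * l) (3 * b) (g + 4 * b)"
  unfolding forces_def
proof (intro allI impI)
  fix P :: "interval list" and x :: real
  assume P: "admissible P"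
  \<comment> \<open>The number \<open>n\<close> exceeds the number of pairs of subsets of a set with
    fewer than \<open>g + 4 * b\<close> colours. Windows of width \<open>d\<close> are separated by
    gaps of width 1, and by \<open>large\<close> all \<open>n\<close> of them fit between
    \<open>x + l\<close> and \<open>x + 2 * l\<close>. The offset \<open>l\<close> leaves room for
    long intervals reaching to the left.\<close>
  define n where "n = (4::nat) ^ (g + 4 * b) + 1"
  define y where "y j = x + l + real j * (d + 1)" for j :: nat
  define Z where "Z = y ` {..<n} \<union> (\<lambda>j. y j + l) ` {..<n}"
  have l0: "0 < l" using l pos by auto
  have y_less: "y i + d + 1 \<le> y j" if "i < j" for i j
  proof -
    have "real (i + 1) * (d + 1) \<le> real j * (d + 1)"
      using that d by (intro mult_right_mono) auto
    then show ?thesis by (simp add: y_def algebra_simps)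
  qed
  have y_top: "y j + d + 1 \<le> x + l + l" if "j < n" for j
  proof -
    have "real (j + 1) * (d + 1) \<le> real n * (d + 1)"
      using that d by (intro mult_right_mono) auto
    then show ?thesis using large by (simp add: y_def n_def algebra_simps)
  qed
  have y_bot: "x + l \<le> y j" for j using d by (simp add: y_def)
  have y_AB: "y i + d < y j + l" if "i < n" for i j
    using y_top[OF that] y_bot[of j] by simp
  have y_mono: "y i < y j \<Longrightarrow> y i + d + 1 \<le> y j" for i j
    using y_less[of i j] y_less[of j i] d by (cases i j rule: linorder_cases) auto
  have sep: "a + d < z" if az: "a \<in> Z" "z \<in> Z" "a < z" for a z
  proof -
    obtain i where a: "a = y i \<or> a = y i + l" and i: "i < n"
      using az(1) by (force simp: Z_def)
    obtain j where z: "z = y j \<or> z = y j + l" and j: "j < n"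
      using az(2) by (force simp: Z_def)
    show ?thesis
      using a z az(3) y_mono[of i j] y_AB[OF i, of j] y_AB[OF j, of i] d by auto
  qed
  have "finite Z" by (simp add: Z_def)
  obtain Q where Q: "admissible Q"
    and QZ: "\<And>I. I \<in> set Q \<Longrightarrow> \<exists>z\<in>Z. z \<le> fst I \<and> snd I \<le> z + d"
    and Qd: "\<And>p. depth p Q \<le> b" and Qg: "\<And>z. z \<in> Z \<Longrightarrow> g \<le> card (zone P Q d z)"
    using forces_zones[OF forces \<open>finite Z\<close> sep P] by blast
  have Zx: "x \<le> z" "z + d \<le> x + 4 * l" if "z \<in> Z" for z
  proof -
    obtain j where "z = y j \<or> z = y j + l" "j < n" using \<open>z \<in> Z\<close> by (force simp: Z_def)
    then show "x \<le> z" "z + d \<le> x + 4 * l" using y_top[of j] y_bot[of j] l0 d by auto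
  qed
  show "\<exists>Q. admissible Q \<and> (\<forall>I\<in>set Q. x \<le> fst I \<and> snd I \<le> x + 4 * l) \<and>
    (\<forall>p. depth p Q \<le> 3 * b) \<and> g + 4 * b \<le> card (colours c P Q)"
  proof (cases "g + 4 * b \<le> card (colours c P Q)")
    case True
    moreover have "x \<le> fst I \<and> snd I \<le> x + 4 * l" if "I \<in> set Q" for I
      using QZ[OF that] Zx by force
    moreover have "depth p Q \<le> 3 * b" for p using Qd[of p] by simp
    ultimately show ?thesis using Q by blast
  next
    case False
    \<comment> \<open>If \<open>Q\<close> alone does not already use enough colours, there are fewer
      than \<open>n\<close> values of \<open>h\<close>.\<close>
    define h where "h j = (zone P Q d (y j), zone P Q d (y j + l))" for j
    let ?M = "Pow (colours c P Q) \<times> Pow (colours c P Q)"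
    have "card (h ` {..<n}) \<le> card ?M"
      using zone_subset_colours by (intro card_mono) (simp_all add: h_def image_subset_iff)
    also have "card ?M = 4 ^ card (colours c P Q)"
      by (simp add: card_cartesian_product card_Pow flip: power_mult_distrib)
    also have "\<dots> < n" using False by (simp add: n_def less_Suc_eq_le)
    finally have "\<not> inj_on h {..<n}" using card_image[of h "{..<n}"] by auto
    then obtain i k where ik: "i < k" "k < n" "h i = h k"
      unfolding inj_on_def by (metis lessThan_iff linorder_neqE_nat)
    define T where "T = zone P Q d (y k)"
    define T' where "T' = zone P Q d (y k + l)"
    have T: "zone P Q d (y i) = T" "zone P Q d (y i + l) = T'"
      using ik by (auto simp: h_def T_def T'_def)
    have finT: "finite T" "finite T'" unfolding T_def T'_def
      by (rule finite_subset[OF zone_subset_colours]; simp)+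
    have cT: "g \<le> card T" "g \<le> card T'" unfolding T_def T'_def using Qg ik by (auto simp: Z_def)
    have TQ: "T \<subseteq> colours c P Q" "T' \<subseteq> colours c P Q"
      unfolding T_def T'_def by (rule zone_subset_colours)+
    \<comment> \<open>A later interval that contains the whole window meets every interval played
      there.\<close>
    have zone_avoid: "zone P Q d z \<inter> colours c (P @ Q @ R) S = {}"
      if "admissible R" "admissible S" "\<And>J. J \<in> set S \<Longrightarrow> fst J \<le> z \<and> z + d \<le> snd J" for z R S
    proof -
      { fix a assume "a \<in> zone P Q d z" and e: "a \<in> colours c (P @ Q @ R) S"
        then obtain I where I: "(I, a) \<in> set (trace c P Q)" "z \<le> fst I" "snd I \<le> z + d"
          by (auto simp: zone_def)
        have "I \<in> set Q" using I fst_set_trace by blast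
        then have "fst I < snd I" using admissible_fst_less_snd Q by blast
        then have "meets I J" if "J \<in> set S" for J
          using \<open>\<And>J. J \<in> set S \<Longrightarrow> fst J \<le> z \<and> z + d \<le> snd J\<close>[OF that] I
            admissible_fst_less_snd[OF \<open>admissible S\<close> that]
          by (subst meets_iff) auto
        then have False
          using colour_neq_later[of P "Q @ R" S I a a] P Q that(1,2) I(1) e
          by (simp add: trace_append) }
      then show ?thesis by blast
    qed

    \<comment> \<open>Window \<open>k - 1\<close> ends at \<open>u\<close> and window
      \<open>k\<close> starts after \<open>v\<close>. So no interval of \<open>Q\<close> meets the
      points after \<open>u\<close> up to \<open>v\<close>, nor their translates by
      \<open>l\<close>.\<close>
    define u where "u = y k - 1"
    define v where "v = y k - 1 / 2"
    have iu: "y i + d \<le> u" using y_less[OF ik(1)] by (simp add: u_def)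
    have uv: "u < v" by (simp add: u_def v_def)
    have vl: "v < u + l" using y_top[OF ik(2)] y_bot[of i] iu d by (auto simp: u_def v_def)
    have gap: "z + d \<le> u \<or> v < z" "z + d \<le> u + l \<or> v + l < z" if "z \<in> Z" for z
    proof -
      have *: "y j + d \<le> u \<or> v < y j" for j
        using y_less[of j k] y_less[of k j] d
        by (cases j k rule: linorder_cases) (auto simp: u_def v_def)
      have **: "y j + d \<le> u + l" "v < y j + l" if "j < n" for j
        using y_top[OF that] y_bot[of j] y_top[OF ik(2)] y_bot[of k] d l0 iu y_bot[of i]
        by (auto simp: u_def v_def)
      obtain j where "z = y j \<or> z = y j + l" "j < n" using \<open>z \<in> Z\<close> by (force simp: Z_def)
      then show "z + d \<le> u \<or> v < z" "z + d \<le> u + l \<or> v + l < z"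
        using *[of j] **[of j] by auto
    qed
    have Q_gap: "depth p Q = 0" if "u < p \<and> p \<le> v \<or> u + l < p \<and> p \<le> v + l" for p
      by (rule depth_0) (use that QZ gap in force)

    \<comment> \<open>These intervals stop short of window \<open>k\<close> but contain window
      \<open>i\<close>, which has the same colour set \<open>T\<close>.\<close>
    define L where "L = replicate b (v - l, v)"
    have L: "admissible L" using l by (auto simp: L_def admissible_def len_def)
    define F where "F = colours c (P @ Q) L"
    have cF: "card F = b"
      using card_colours_clique[of "P @ Q" L] P Q L l0
      by (simp add: F_def) (auto simp: L_def meets_iff)
    have "T \<inter> F = {}"
      using zone_avoid[of "[]" L "y i"] L T iu uv y_bot[of i] y_top[OF ik(2)] d
      by (auto simp: F_def L_def admissible_def v_def u_def)

    \<comment> \<open>These intervals start in the translated gap, right of the translate of window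
      \<open>i\<close>. They contain the translate of window \<open>k\<close>, which makes them
      avoid \<open>T'\<close>.\<close>
    obtain R q where lR: "length R = 2 * b" and q: "u + l < q" "q < v + l"
      and R_iv: "\<And>I. I \<in> set R \<Longrightarrow> u + l < fst I \<and> fst I < v + l \<and> snd I = fst I + l"
      and R_few: "length (filter (\<lambda>I. fst I \<le> q) R) \<le> b"
      and R_out: "\<forall>(I, a)\<in>set (trace c (P @ Q @ L) R). fst I \<le> q \<longrightarrow> a \<notin> T \<union> F"
      and R_in: "length (filter (\<lambda>I. fst I \<le> q) R) = b \<or>
        (\<forall>(I, a)\<in>set (trace c (P @ Q @ L) R). q < fst I \<longrightarrow> a \<in> T \<union> F)"
      using separation[of "u + l" "v + l" "2 * b" l b "P @ Q @ L" "T \<union> F"] uv by auto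
    have R: "admissible R" using R_iv l by (auto simp: admissible_def len_def)
    have dR: "distinct (map snd (trace c (P @ Q @ L) R))"
    proof (rule distinct_colours_clique)
      show "meets I J" if "I \<in> set R" "J \<in> set R" for I J
        using R_iv[OF that(1)] R_iv[OF that(2)] l0 y_top[OF ik(2)] y_bot[of i] iu d
        by (subst meets_iff) (auto simp: u_def v_def)
    qed (use P Q L R in auto)
    define ER where "ER = filter (\<lambda>p. fst (fst p) \<le> q) (trace c (P @ Q @ L) R)"
    define E where "E = snd ` set ER"
    have cE: "card E = length (filter (\<lambda>I. fst I \<le> q) R)"
    proof -
      have "card E = length ER"
        using distinct_card[OF distinct_map_filter[OF dR, of "\<lambda>p. fst (fst p) \<le> q"]]
        by (simp add: E_def ER_def)
      also have "\<dots> = length (filter (\<lambda>I. fst I \<le> q) (map fst (trace c (P @ Q @ L) R)))"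
        by (simp only: ER_def filter_map length_map comp_def)
      finally show ?thesis by simp
    qed
    have E_out: "E \<inter> (T \<union> F) = {}" using R_out by (auto simp: E_def ER_def)
    have E_sub: "E \<subseteq> colours c (P @ Q @ L) R" by (auto simp: E_def ER_def colours_def)
    have cR: "card (colours c (P @ Q @ L) R) = 2 * b"
      using distinct_card[OF dR] lR by (simp add: colours_def)
    have TR: "T' \<inter> colours c (P @ Q @ L) R = {}"
      unfolding T'_def using R_iv y_top[OF ik(2)] y_bot[of i] iu d L R
      by (intro zone_avoid) (force simp: u_def v_def)+
    have "finite F" "finite E" by (auto simp: F_def E_def)
    define W where "W = T \<union> T' \<union> F \<union> E"
    have finW: "finite W" using finT \<open>finite F\<close> \<open>finite E\<close> by (simp add: W_def)
    have cW: "g + 2 * b \<le> card W"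
    proof (cases "card E = b")
      case True
      have "g + 2 * b \<le> card T + card F + card E" using cT cF True by simp
      also have "\<dots> = card (T \<union> F \<union> E)"
        using finT \<open>finite F\<close> \<open>finite E\<close> \<open>T \<inter> F = {}\<close> E_out
        by (subst card_Un_disjoint | auto)+
      also have "\<dots> \<le> card W" using finW by (intro card_mono) (auto simp: W_def)
      finally show ?thesis .
    next
      case False
      then have "colours c (P @ Q @ L) R \<subseteq> T \<union> F \<union> E"
        using R_in cE by (force simp: colours_def E_def ER_def)
      then have "T' \<union> colours c (P @ Q @ L) R \<subseteq> W" by (auto simp: W_def)
      then have "card T' + card (colours c (P @ Q @ L) R) \<le> card W"
        using TR finT finW by (metis card_Un_disjoint card_mono finite_colours)
      then show ?thesis using cT cR by simp
    qed

    \<comment> \<open>The left end \<open>q - l\<close> lies in the gap, so these intervals contain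
      window \<open>k\<close> and the translate of window \<open>i\<close>, and still meet
      \<open>L\<close>. Ending at \<open>q\<close>, they meet exactly those intervals of
      \<open>R\<close> whose colours form \<open>E\<close>.\<close>
    define B where "B = replicate (2 * b) (q - l, q)"
    have B: "admissible B" using l by (auto simp: B_def admissible_def len_def)
    define K where "K = colours c (P @ Q @ L @ R) B"
    have cK: "card K = 2 * b"
      using card_colours_clique[of "P @ Q @ L @ R" B] P Q L R B l0
      by (simp add: K_def) (auto simp: B_def meets_iff)
    have TK: "T \<inter> K = {}"
      unfolding T_def K_def using q y_top[OF ik(2)] y_bot[of i] iu d L R B
      by (intro zone_avoid[of "L @ R", simplified]) (auto simp: u_def v_def B_def)
    have T'K: "T' \<inter> K = {}"
      unfolding T(2)[symmetric] K_def using q y_top[OF ik(2)] y_bot[of i] iu d L R B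
      by (intro zone_avoid[of "L @ R", simplified]) (auto simp: u_def v_def B_def)
    have FK: "F \<inter> K = {}"
    proof -
      have "a \<noteq> e" if ae: "a \<in> F" "e \<in> K" for a e
      proof -
        obtain I where I: "(I, a) \<in> set (trace c (P @ Q) L)"
          using ae(1) by (force simp: F_def colours_def)
        have "I \<in> set L" using I fst_set_trace by blast
        then have m: "meets I J" if "J \<in> set B" for J
          using that q uv l0 y_top[OF ik(2)] y_bot[of i] iu d
          by (subst meets_iff) (auto simp: B_def L_def u_def v_def)
        show ?thesis
        proof (rule colour_neq_later[OF _ _ B _ _ m])
          show "(I, a) \<in> set (trace c (P @ Q) (L @ R))" using I by (simp add: trace_append)
          show "e \<in> colours c ((P @ Q) @ L @ R) B" using ae(2) by (simp add: K_def)
        qed (use P Q L R in simp_all)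
      qed
      then show ?thesis by blast
    qed
    have EK: "E \<inter> K = {}"
    proof -
      have "a \<noteq> e" if ae: "a \<in> E" "e \<in> K" for a e
      proof -
        obtain I where I: "(I, a) \<in> set (trace c (P @ Q @ L) R)" "fst I \<le> q"
          using ae(1) unfolding E_def ER_def by auto
        have "I \<in> set R" using I fst_set_trace by blast
        then have m: "meets I J" if "J \<in> set B" for J
          using that q uv vl l0 I R_iv[of I]
          by (subst meets_iff) (auto simp: B_def)
        show ?thesis
        proof (rule colour_neq_later[OF _ _ B _ _ m])
          show "(I, a) \<in> set (trace c (P @ Q @ L) R)" by (rule I(1))
          show "e \<in> colours c ((P @ Q @ L) @ R) B" using ae(2) by (simp add: K_def)
        qed (use P Q L R in simp_all)
      qed
      then show ?thesis by blast
    qed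
    have "W \<inter> K = {}" using TK T'K FK EK by (auto simp: W_def)
    let ?S = "Q @ L @ R @ B"
    have "g + 4 * b \<le> card W + card K" using cW cK by simp
    also have "\<dots> = card (W \<union> K)"
      using \<open>W \<inter> K = {}\<close> finW by (simp add: card_Un_disjoint K_def)
    also have "\<dots> \<le> card (colours c P ?S)"
      using TQ E_sub by (intro card_mono) (auto simp: colours_append W_def F_def K_def)
    finally have "g + 4 * b \<le> card (colours c P ?S)" .
    moreover have "admissible ?S" using Q L R B by simp
    moreover have "x \<le> fst I \<and> snd I \<le> x + 4 * l" if IS: "I \<in> set ?S" for I
    proof -
      consider "I \<in> set Q" | "I \<in> set L" | "I \<in> set R" | "I \<in> set B" using IS by auto
      then show ?thesis
      proof cases
        case 1
        then show ?thesis using QZ[OF 1] Zx by force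
      next
        case 3
        then show ?thesis using R_iv[of I] y_top[OF ik(2)] y_bot[of i] iu d l0
          by (auto simp: u_def v_def)
      next
        case 2
        then have "I = (v - l, v)" by (auto simp: L_def)
        then show ?thesis using y_top[OF ik(2)] y_bot[of i] iu d l0 by (simp add: u_def v_def)
      next
        case 4
        then have "I = (q - l, q)" by (auto simp: B_def)
        then show ?thesis using q y_top[OF ik(2)] y_bot[of i] iu d l0 by (simp add: u_def v_def)
      qed
    qed
    moreover have "depth p ?S \<le> 3 * b" for p
    proof -
      have dL: "depth p L = (if v - l \<le> p \<and> p \<le> v then b else 0)"
        by (simp add: L_def depth_replicate)
      have dB: "depth p B = (if q - l \<le> p \<and> p \<le> q then 2 * b else 0)"
        by (simp add: B_def depth_replicate)
      have dR2: "depth p R \<le> 2 * b" using depth_le_length[of p R] lR by simp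
      have dR0: "depth p R = 0" if "p \<le> u + l" using R_iv that by (intro depth_0) force
      have dRb: "depth p R \<le> b" if "p \<le> q"
      proof -
        have "depth p R \<le> length (filter (\<lambda>I. fst I \<le> q) R)"
          unfolding depth_def using that by (induction R) auto
        then show ?thesis using R_few by simp
      qed
      \<comment> \<open>The depths of \<open>Q\<close>, \<open>L\<close>, \<open>R\<close>,
        \<open>B\<close> are bounded, in this order of cases, by \<open>b, b, 0, 0\<close>;
        \<open>0, b, 0, 2 * b\<close>; \<open>b, 0, 0, 2 * b\<close>; \<open>0, 0, b, 2 * b\<close>;
        \<open>b, 0, 2 * b, 0\<close>. The fourth case needs the bound \<open>b\<close> on the
        intervals of \<open>R\<close> starting at or before \<open>q\<close>.\<close>
      consider "p < q - l" | "q - l \<le> p" "p \<le> v" | "v < p" "p \<le> u + l"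
        | "u + l < p" "p \<le> q" | "q < p" by linarith
      then show ?thesis
      proof cases
        case 1
        then show ?thesis using dL dB dR0 Qd[of p] q uv vl l0 by simp
      next
        case 2
        then show ?thesis using dL dB dR0 Q_gap[of p] q uv vl l0 by simp
      next
        case 3
        then show ?thesis using dL dB dR0 Qd[of p] q uv vl l0 by simp
      next
        case 4
        then show ?thesis using dL dB dRb Q_gap[of p] q uv vl l0 by simp
      next
        case 5
        then show ?thesis using dL dB dR2 Qd[of p] q uv vl l0 by simp
      qed
    qed
    ultimately show ?thesis by blast
  qed
qed

end

section \<open>Depth bounds the chromatic number\<close>

text \<open>Greedy colouring by increasing left endpoint: all previously coloured neighbours of the
  new interval contain its left endpoint, so fewer than \<open>k\<close> colours are
  blocked.\<close>

lemma interval_colouring: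
  fixes f :: "nat \<Rightarrow> interval"
  assumes "finite V" "\<And>v. v \<in> V \<Longrightarrow> fst (f v) \<le> snd (f v)"
    "\<And>p. card {v \<in> V. fst (f v) \<le> p \<and> p \<le> snd (f v)} \<le> k"
  shows "\<exists>h. h ` V \<subseteq> {..<k} \<and> (\<forall>u\<in>V. \<forall>v\<in>V. u \<noteq> v \<longrightarrow> meets (f u) (f v) \<longrightarrow> h u \<noteq> h v)"
  using assms
proof (induction V rule: finite_ranking_induct[where f = "\<lambda>v. fst (f v)"])
  case empty
  then show ?case by simp
next
  case (insert x S)
  show ?case
  proof (cases "x \<in> S")
    case True
    then have "insert x S = S" by blast
    then show ?thesis using insert.IH insert.prems by simp
  next
    case False
    have "card {v \<in> S. fst (f v) \<le> p \<and> p \<le> snd (f v)} \<le> k" for p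
      using insert.prems(2)[of p] card_mono[of "{v \<in> insert x S. fst (f v) \<le> p \<and> p \<le> snd (f v)}"
          "{v \<in> S. fst (f v) \<le> p \<and> p \<le> snd (f v)}"] insert.hyps by fastforce
    then obtain h where h: "h ` S \<subseteq> {..<k}"
      "\<And>u v. u \<in> S \<Longrightarrow> v \<in> S \<Longrightarrow> u \<noteq> v \<Longrightarrow> meets (f u) (f v) \<Longrightarrow> h u \<noteq> h v"
      using insert.IH insert.prems(1) by (metis insertI2)
    define N where "N = {v \<in> S. meets (f x) (f v)}"
    have fN: "finite N" using insert.hyps by (simp add: N_def)
    have "insert x N \<subseteq> {v \<in> insert x S. fst (f v) \<le> fst (f x) \<and> fst (f x) \<le> snd (f v)}"
      using insert.hyps insert.prems(1) by (auto simp: N_def meets_iff)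
    then have "card (insert x N) \<le> k"
      using insert.prems(2)[of "fst (f x)"] insert.hyps(1)
        card_mono[of "{v \<in> insert x S. fst (f v) \<le> fst (f x) \<and> fst (f x) \<le> snd (f v)}" "insert x N"]
      by force
    then have "card N < k" using fN False by (simp add: N_def)
    then have "card (h ` N) < card {..<k}" using card_image_le[OF fN, of h] by simp
    then obtain a where a: "a < k" "a \<notin> h ` N"
      by (metis card_mono finite_imageI[OF fN] lessThan_iff not_less subsetI)
    have new: "h v \<noteq> a" if "v \<in> S" "meets (f x) (f v) \<or> meets (f v) (f x)" for v
      using that a(2) by (auto simp: N_def meets_def Int_commute)
    have "(if u = x then a else h u) \<noteq> (if v = x then a else h v)"
      if "u \<in> insert x S" "v \<in> insert x S" "u \<noteq> v" "meets (f u) (f v)" for u v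
      using that h(2)[of u v] new[of u] new[of v] by auto
    moreover have "(\<lambda>v. if v = x then a else h v) ` insert x S \<subseteq> {..<k}"
      using h(1) a(1) by auto
    ultimately show ?thesis
      by (intro exI[of _ "\<lambda>v. if v = x then a else h v"]) blast
  qed
qed

text \<open>Vertices are positions in the list, because the strategy presents equal intervals
  several times.\<close>

definition overlap_graph :: "interval list \<Rightarrow> ngraph" where
  "overlap_graph Is = \<lparr>pverts = {..<length Is},
     parcs = {(i, j). i < length Is \<and> j < length Is \<and> i \<noteq> j \<and> meets (Is ! i) (Is ! j)}\<rparr>"

lemma pair_graph_overlap_graph: "pair_graph (overlap_graph Is)"
proof -
  have "finite {(i, j). i < length Is \<and> j < length Is \<and> i \<noteq> j \<and> meets (Is ! i) (Is ! j)}"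
    by (rule finite_subset[of _ "{..<length Is} \<times> {..<length Is}"]) auto
  then show ?thesis
    by unfold_locales
      (auto simp: overlap_graph_def symmetric_def meets_def intro!: symI dest: symD)
qed

lemma chromatic_number_overlap_graph:
  assumes "\<And>I. I \<in> set Is \<Longrightarrow> fst I \<le> snd I" "\<And>p. depth p Is \<le> k"
  shows "chromatic_number (overlap_graph Is) \<le> k"
proof -
  have "card {v \<in> {..<length Is}. fst (Is ! v) \<le> p \<and> p \<le> snd (Is ! v)} \<le> k" for p
    using assms(2)[of p] by (simp add: depth_def length_filter_conv_card)
  then obtain h where "h ` {..<length Is} \<subseteq> {..<k}" "\<forall>u\<in>{..<length Is}. \<forall>v\<in>{..<length Is}.
      u \<noteq> v \<longrightarrow> meets (Is ! u) (Is ! v) \<longrightarrow> h u \<noteq> h v"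
    using interval_colouring[of "{..<length Is}" "\<lambda>i. Is ! i" k] assms(1) by auto
  then show ?thesis unfolding chromatic_number_def
    by (intro Least_le exI[of _ h]) (auto simp: overlap_graph_def)
qed

section \<open>From the game to the competitive ratio\<close>

lemma many_colours:
  assumes "online_colouring_algorithm A"
  shows "\<exists>G. two_count_interval_graph G \<and> chromatic_number G \<le> 9 * m \<and> 16 * m \<le> chi_alg A G"
proof -
  \<comment> \<open>Each length is chosen to satisfy \<open>large\<close> in its step:
    \<open>s\<close> with \<open>d = 0\<close>, \<open>g = 0\<close>, \<open>b = m\<close>, and
    \<open>t\<close> with \<open>d = 4 * s\<close>, \<open>g = 4 * m\<close>,
    \<open>b = 3 * m\<close>. Both depend on \<open>m\<close> alone.\<close>
  define s :: real where "s = real (4 ^ (4 * m) + 1)"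
  define t :: real where "t = real (4 ^ (16 * m) + 1) * (4 * s + 1)"
  have s: "0 < s" by (simp add: s_def add_pos_pos)
  have "1 * (4 * s + 1) \<le> t" unfolding t_def using s by (intro mult_right_mono) auto
  then have st: "s < t" using s by simp
  interpret online_game s t "A s t"
    using assms s st
    by unfold_locales (auto simp: online_colouring_algorithm_def colour_def)
  have "forces (4 * s) (3 * m) (4 * m)"
    using forces_step[OF forces_nothing[of m], of s] by (simp add: s_def)
  then have "forces (4 * t) (9 * m) (16 * m)"
    using forces_step[of "4 * s" "3 * m" "4 * m" t] s by (simp add: t_def)
  then obtain Is where Is: "admissible Is" "\<And>p. depth p Is \<le> 9 * m"
    "16 * m \<le> card (colours (A s t) [] Is)"
    unfolding forces_def by (metis admissible_def empty_iff empty_set)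
  let ?G = "overlap_graph Is"
  have rep: "interval_representation ?G ((!) Is)"
    using admissible_fst_less_snd[OF Is(1)]
    by (auto simp: interval_representation_def overlap_graph_def)
  have lens: "(\<lambda>v. len (Is ! v)) ` pverts ?G \<subseteq> {s, t}"
    using Is(1) by (auto simp: admissible_def overlap_graph_def)
  have two: "two_count_interval_graph ?G"
    unfolding two_count_interval_graph_def
    using pair_graph_overlap_graph rep card_mono[OF _ lens] st by (intro conjI exI[of _ "(!) Is"]) auto
  have "presentation ?G s t ((!) Is) [0..<length Is]"
    using rep lens s st by (auto simp: presentation_def overlap_graph_def image_subset_iff)
  moreover have "map ((!) Is) [0..<length Is] = Is" by (rule map_nth)
  ultimately have "colours_used A s t Is \<le> chi_alg A ?G"
    unfolding chi_alg_def
    by (intro Max_ge finite_colours_used pair_graph_overlap_graph CollectI) (metis (no_types))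
  then have "16 * m \<le> chi_alg A ?G"
    using Is(3) by (simp add: colours_used_def colours_eq_image)
  moreover have "chromatic_number ?G \<le> 9 * m"
    using chromatic_number_overlap_graph Is(2) admissible_fst_less_snd[OF Is(1)] less_imp_le by blast
  ultimately show ?thesis using two by blast
qed

lemma competitive_ge:
  assumes A: "online_colouring_algorithm A" and "competitive A \<rho>"
  shows "16 / 9 \<le> \<rho>"
proof (rule ccontr)
  assume less: "\<not> 16 / 9 \<le> \<rho>"
  obtain b where b: "\<And>G. two_count_interval_graph G \<Longrightarrow>
      real (chi_alg A G) \<le> \<rho> * real (chromatic_number G) + b"
    using assms(2) by (auto simp: competitive_def)
  \<comment> \<open>The chromatic number is only bounded from above, so the estimate needs a
    nonnegative factor.\<close>
  define r where "r = max \<rho> 0"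
  have r: "\<rho> \<le> r" "0 \<le> r" "r < 16 / 9" using less by (auto simp: r_def)
  \<comment> \<open>The forced excess \<open>m * (16 - 9 * r)\<close> grows with \<open>m\<close>
    and eventually exceeds the additive constant.\<close>
  obtain m :: nat where m: "b < real m * (16 - 9 * r)"
    using reals_Archimedean3[of "16 - 9 * r"] r by auto
  obtain G where G: "two_count_interval_graph G" "chromatic_number G \<le> 9 * m" "16 * m \<le> chi_alg A G"
    using many_colours[OF A] by blast
  have "16 * real m \<le> real (chi_alg A G)" using G(3) by linarith
  also have "\<dots> \<le> \<rho> * real (chromatic_number G) + b" by (rule b[OF G(1)])
  also have "\<dots> \<le> r * (9 * real m) + b"
    using r G(2) by (intro add_right_mono mult_mono) auto
  finally show False using m by (simp add: algebra_simps)
qed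

theorem theorem19:
  shows "two_plus_plus \<ge> ereal (7 / 4) \<and>
         \<not> (\<exists>A. online_colouring_algorithm A \<and> competitive_ratio A < ereal (7 / 4))"
proof -
  \<comment> \<open>Every competitive \<open>\<rho>\<close> is at least 16/9 = 64/36, and 7/4 =
    63/36. If there is none, the infimum is infinite.\<close>
  have *: "ereal (7 / 4) \<le> competitive_ratio A" if "online_colouring_algorithm A" for A
    unfolding competitive_ratio_def using competitive_ge[OF that] by (fastforce intro: Inf_greatest)
  then show ?thesis unfolding two_plus_plus_def by (force intro: Inf_greatest)
qed

end
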